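(* Let $n\ge7$ be odd, let $\Gamma=(X,\mathcal{R})$ be the halved cube $\frac12H(n,2)$, let $D=(n-1)/2$ (its diameter), and fix $x\in X$. For $2\le i\le D$ put $e_i^-=\frac{4i-1-2D}{6-8i+4D}$, for $1\le i\le D-1$ put $e_i^+=\frac{4i-5-2D}{6-8i+4D}$, and for $1\le i\le D$ put $f_i=-(4i-5)(4i-1)+(16i-12)D-4D^2$ (with $e_1^-=e_D^+=0$). Then $$e_i^-RL^2+LRL+e_i^+L^2R=f_iL$$ holds on $E_i^*V$ for every $1\le i\le D$. In particular, $\Gamma$ supports a strongly uniform structure with respect to $x$.
   Context: Halved cube $\frac12H(n,2)$: vertices are the binary $n$-tuples of even weight, adjacent iff they differ in exactly two coordinates. With distance $\partial$: $V=\mathbb{C}^X$, $A$ the adjacency matrix, $E_i^*$ the diagonal $0/1$ matrix with $(y,y)$-entry $1$ iff $\partial(x,y)=i$; $L=\sum_{i=1}^{D}E^*_{i-1}AE^*_i$, $R=\sum_{i=0}^{D-1}E^*_{i+1}AE^*_i=L^\top$. $\Gamma_f$ is the graph on $X$ whose edges are the edges $yz$ of $\Gamma$ with $\partial(x,y)\ne\partial(x,z)$ (bipartite with lowering/raising matrices $L,R$). A parameter matrix is a tridiagonal complex $U=(e_{ij})_{1\le i,j\le D}$ with $e_{ii}=1$, with $e_{i,i-1}\ne0$ for all $2\le i\le D$ or $e_{i-1,i}\ne0$ for all $2\le i\le D$, and every principal submatrix $(e_{ij})_{s\le i,j\le t}$ nonsingular; $e_i^-=e_{i,i-1}$, $e_i^+=e_{i,i+1}$.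 A uniform structure of $\Gamma_f$ w.r.t. $x$ is a pair $(U,f)$, $f\in\mathbb{C}^D$, with $e_i^-RL^2+LRL+e_i^+L^2R=f_iL$ on $E_i^*V$ for all $1\le i\le D$; strongly uniform if all $e_i^-$ ($2\le i\le D$) and $e_i^+$ ($1\le i\le D-1$) are nonzero. $\Gamma$ supports a strongly uniform structure w.r.t. $x$ if $\Gamma_f$ admits one. *)

theory Defs
  imports "HOL-Analysis.Analysis" "Jordan_Normal_Form.Determinant"
begin

no_notation Matrix.vec_index (infixl "$" 100)

text \<open>
  A graph on a finite vertex type is given by its set of ordered adjacent pairs.
  The space \<open>V\<close> is \<^typ>\<open>complex ^ 'v\<close>.
\<close>

text \<open>Only meaningful for vertices in the same component.\<close>

definition graph_dist :: "'v rel \<Rightarrow> 'v \<Rightarrow> 'v \<Rightarrow> nat" where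
  "graph_dist G x y = (LEAST k. (x, y) \<in> G ^^ k)"

definition graph_diameter :: "('v::finite) rel \<Rightarrow> nat" where
  "graph_diameter G = Max {graph_dist G x y | x y. True}"

definition adjacency_matrix :: "('v::finite) rel \<Rightarrow> complex ^ 'v ^ 'v" where
  "adjacency_matrix G = (\<chi> y z. if (y, z) \<in> G then 1 else 0)"

definition dual_idempotent :: "('v::finite) rel \<Rightarrow> 'v \<Rightarrow> nat \<Rightarrow> complex ^ 'v ^ 'v" where
  "dual_idempotent G x i = (\<chi> y z. if y = z \<and> graph_dist G x y = i then 1 else 0)"

definition lowering_matrix :: "nat \<Rightarrow> ('v::finite) rel \<Rightarrow> 'v \<Rightarrow> complex ^ 'v ^ 'v" where
  "lowering_matrix D G x =
     (\<Sum>i = 1..D. dual_idempotent G x (i - 1) ** adjacency_matrix G ** dual_idempotent G x i)"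

definition raising_matrix :: "nat \<Rightarrow> ('v::finite) rel \<Rightarrow> 'v \<Rightarrow> complex ^ 'v ^ 'v" where
  "raising_matrix D G x =
     (\<Sum>i = 0..<D. dual_idempotent G x (i + 1) ** adjacency_matrix G ** dual_idempotent G x i)"

definition uniform_relation ::
  "nat \<Rightarrow> ('v::finite) rel \<Rightarrow> 'v \<Rightarrow> nat \<Rightarrow> complex \<Rightarrow> complex \<Rightarrow> complex \<Rightarrow> bool" where
  "uniform_relation D G x i em ep c \<longleftrightarrow>
     (let L = lowering_matrix D G x; R = raising_matrix D G x
      in \<forall>v \<in> range (\<lambda>w. dual_idempotent G x i *v w).
           em *s ((R ** L ** L) *v v) + (L ** R ** L) *v v + ep *s ((L ** L ** R) *v v)
             = c *s (L *v v))"

text \<open>The graph \<open>\<Gamma>\<^sub>f\<close> with respect to \<open>x\<close>.\<close>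

definition bipartite_part :: "'v rel \<Rightarrow> 'v \<Rightarrow> 'v rel" where
  "bipartite_part G x = {(y, z) \<in> G. graph_dist G x y \<noteq> graph_dist G x z}"

text \<open>
  A parameter matrix is encoded as a function of two indices in \<open>{1..D}\<close>; its values
  outside this range are irrelevant. The matrix whose determinant is taken is the principal
  submatrix \<open>(U i j)\<close> with \<open>s \<le> i, j \<le> t\<close>, shifted to the zero-based
  indexing of matrices.
\<close>

definition parameter_matrix :: "nat \<Rightarrow> (nat \<Rightarrow> nat \<Rightarrow> complex) \<Rightarrow> bool" where
  "parameter_matrix D U \<longleftrightarrow>
     (\<forall>i\<in>{1..D}. \<forall>j\<in>{1..D}. i + 1 < j \<or> j + 1 < i \<longrightarrow> U i j = 0) \<and>
     (\<forall>i\<in>{1..D}. U i i = 1) \<and>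
     ((\<forall>i\<in>{2..D}. U i (i - 1) \<noteq> 0) \<or> (\<forall>i\<in>{2..D}. U (i - 1) i \<noteq> 0)) \<and>
     (\<forall>s t. 1 \<le> s \<and> s \<le> t \<and> t \<le> D \<longrightarrow>
        Determinant.det (Matrix.mat (t + 1 - s) (t + 1 - s) (\<lambda>(i, j). U (s + i) (s + j))) \<noteq> 0)"

definition e_minus :: "(nat \<Rightarrow> nat \<Rightarrow> complex) \<Rightarrow> nat \<Rightarrow> complex" where
  "e_minus U i = (if i = 1 then 0 else U i (i - 1))"

definition e_plus :: "nat \<Rightarrow> (nat \<Rightarrow> nat \<Rightarrow> complex) \<Rightarrow> nat \<Rightarrow> complex" where
  "e_plus D U i = (if i = D then 0 else U i (i + 1))"

text \<open>
  The number \<open>D\<close> is an argument because it is the diameter of the graph \<open>\<Gamma>\<close>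
  one starts from, whereas \<open>G\<close> will be \<open>\<Gamma>\<^sub>f\<close>.
  Only the values of \<open>f\<close> on \<open>{1..D}\<close> matter.
\<close>

definition uniform_structure ::
  "nat \<Rightarrow> ('v::finite) rel \<Rightarrow> 'v \<Rightarrow> (nat \<Rightarrow> nat \<Rightarrow> complex) \<Rightarrow> (nat \<Rightarrow> complex) \<Rightarrow> bool" where
  "uniform_structure D G x U f \<longleftrightarrow>
     parameter_matrix D U \<and>
     (\<forall>i\<in>{1..D}. uniform_relation D G x i (e_minus U i) (e_plus D U i) (f i))"

definition strongly_uniform_structure ::
  "nat \<Rightarrow> ('v::finite) rel \<Rightarrow> 'v \<Rightarrow> (nat \<Rightarrow> nat \<Rightarrow> complex) \<Rightarrow> (nat \<Rightarrow> complex) \<Rightarrow> bool" where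
  "strongly_uniform_structure D G x U f \<longleftrightarrow>
     uniform_structure D G x U f \<and>
     (\<forall>i\<in>{2..D}. e_minus U i \<noteq> 0) \<and> (\<forall>i\<in>{1..D-1}. e_plus D U i \<noteq> 0)"

definition supports_strongly_uniform_structure :: "('v::finite) rel \<Rightarrow> 'v \<Rightarrow> bool" where
  "supports_strongly_uniform_structure G x \<longleftrightarrow>
     (\<exists>U f. strongly_uniform_structure (graph_diameter G) (bipartite_part G x) x U f)"

text \<open>Binary \<open>n\<close>-tuples of even weight, where \<open>n\<close> is the cardinality of the index type.\<close>

typedef 'n even_word = "{v :: bool ^ ('n::finite). even (card {i. v $ i})}"
proof
  have "{i. (\<chi> j::'n. False) $ i} = {}"
    using vec_lambda_beta by fastforce
  then show "(\<chi> j. False) \<in> {v :: bool ^ 'n. even (card {i. v $ i})}"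
    by (metis (mono_tags, lifting) card.empty even_zero mem_Collect_eq)
qed

instance even_word :: (finite) finite
proof
  have "(UNIV :: 'a even_word set) = range Abs_even_word"
    by (metis (no_types, lifting) Rep_even_word_inverse surj_def)
  then show "finite (UNIV :: 'a even_word set)"
    by (metis finite finite_imageI)
qed

definition halved_cube :: "('n::finite) even_word rel" where
  "halved_cube = {(y, z). card {i. Rep_even_word y $ i \<noteq> Rep_even_word z $ i} = 2}"

end

theory Submission
  imports Defs
begin

text \<open>
  Identify a vertex with the set of coordinates in which it differs from \<open>x\<close>, so that the
  distance from \<open>x\<close> is half the cardinality. On functions on subsets of the \<open>n\<close> coordinates let
  \<open>d\<close> and \<open>u\<close> be the lowering and raising operators of the Boolean lattice; then \<open>L = d\<^sup>2 / 2\<close>,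
  \<open>R = u\<^sup>2 / 2\<close>, and \<open>du - ud\<close> is the scalar \<open>n - 2w\<close> on sets of size \<open>w\<close>. Put
  \<open>a = 2D + 5 - 4i\<close> and let \<open>N = ud\<close> act on sets of size \<open>2i - 2\<close>. The three terms of the relation
  become \<open>N(N - a - 2)\<close>, \<open>(N + a)(N + 2a - 2)\<close> and \<open>(N + 3a - 6)(N + 4a - 12)\<close> times \<open>d\<^sup>2\<close>, and the
  relation is an identity between quadratic polynomials in \<open>N\<close>.

  Writing \<open>a\<^sub>i\<close> for this \<open>a\<close>, the \<open>i\<close>-th row of the parameter matrix is proportional to
  \<open>(- a\<^bsub>i+1\<^esub>, a\<^sub>i + a\<^bsub>i+1\<^esub>, - a\<^sub>i)\<close>. Hence successive differences of a null vector of a principal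
  submatrix, extended by zero at both ends, are proportional to the \<open>a\<^sub>i\<close>. They add up to zero, whereas
  a sum of consecutive \<open>a\<^sub>i\<close> is its number of terms times an odd integer.
\<close>

section \<open>Lowering and raising in the Boolean lattice\<close>

definition down :: "complex ^ ('n::finite set) \<Rightarrow> complex ^ 'n set" where
  "down F = (\<chi> S. \<Sum>i\<in>-S. F $ insert i S)"

definition up :: "complex ^ ('n::finite set) \<Rightarrow> complex ^ 'n set" where
  "up F = (\<chi> S. \<Sum>i\<in>S. F $ (S - {i}))"

text \<open>The weight is an integer because \<open>down\<close> may push it below 0. The zero
  function has every weight, so weights that no set attains are harmless.\<close>

definition level :: "int \<Rightarrow> complex ^ ('n::finite set) \<Rightarrow> bool" where
  "level w F \<longleftrightarrow> (\<forall>S. F $ S \<noteq> 0 \<longrightarrow> int (card S) = w)"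

lemma down_add: "down (F + G) = down F + down G"
  by (simp add: down_def Finite_Cartesian_Product.vec_eq_iff sum.distrib)

lemma down_scale: "down (c *s F) = c *s down F"
  by (simp add: down_def Finite_Cartesian_Product.vec_eq_iff sum_distrib_left)

lemma up_add: "up (F + G) = up F + up G"
  by (simp add: up_def Finite_Cartesian_Product.vec_eq_iff sum.distrib)

lemma up_scale: "up (c *s F) = c *s up F"
  by (simp add: up_def Finite_Cartesian_Product.vec_eq_iff sum_distrib_left)

lemma down_diff: "down (F - G) = down F - down G"
  by (simp add: down_def Finite_Cartesian_Product.vec_eq_iff sum_subtractf)

lemma up_diff: "up (F - G) = up F - up G"
  by (simp add: up_def Finite_Cartesian_Product.vec_eq_iff sum_subtractf)

lemma level_down:
  assumes "level w F"
  shows "level (w - 1) (down F)"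
  unfolding level_def
proof (intro allI impI)
  fix S assume "down F $ S \<noteq> 0"
  then obtain i where "i \<in> -S" "F $ insert i S \<noteq> 0"
    by (auto simp: down_def elim: sum.not_neutral_contains_not_neutral)
  with assms show "int (card S) = w - 1"
    by (force simp: level_def)
qed

lemma level_up:
  assumes "level w F"
  shows "level (w + 1) (up F)"
  unfolding level_def
proof (intro allI impI)
  fix S assume "up F $ S \<noteq> 0"
  then obtain i where i: "i \<in> S" "F $ (S - {i}) \<noteq> 0"
    by (auto simp: up_def elim: sum.not_neutral_contains_not_neutral)
  with assms have "int (card (S - {i})) = w"
    unfolding level_def by blast
  moreover have "card S = Suc (card (S - {i}))"
    by (rule card.remove) (use i in simp_all)
  ultimately show "int (card S) = w + 1"
    by simp
qed

lemma level_eq_0: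
  fixes F :: "complex ^ ('n::finite set)"
  assumes "level w F" "w < 0 \<or> w > int CARD('n)"
  shows "F = 0"
proof -
  have "F $ S = 0" for S
    using assms card_mono[of UNIV S] by (fastforce simp: level_def)
  then show ?thesis
    by (simp add: Finite_Cartesian_Product.vec_eq_iff)
qed

text \<open>Adding one element and removing a different one commute, so the mixed terms agree on
  both sides. What remains is \<open>F $ S\<close> once for each element outside \<open>S\<close>,
  against once for each element of \<open>S\<close>.\<close>

lemma down_up:
  fixes F :: "complex ^ ('n::finite set)"
  assumes "level w F"
  shows "down (up F) = up (down F) + of_int (int CARD('n) - 2 * w) *s F"
proof -
  have "down (up F) $ S = up (down F) $ S + of_int (int CARD('n) - 2 * w) * F $ S" for S
  proof -
    have "down (up F) $ S = (\<Sum>i\<in>-S. F $ S + (\<Sum>j\<in>S. F $ insert i (S - {j})))"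
      unfolding down_def up_def vec_lambda_beta
    proof (rule sum.cong)
      fix i assume i: "i \<in> -S"
      then have "insert i S - {j} = insert i (S - {j})" if "j \<in> S" for j
        using that by auto
      then show "(\<Sum>j\<in>insert i S. F $ (insert i S - {j})) = F $ S + (\<Sum>j\<in>S. F $ insert i (S - {j}))"
        using i by simp
    qed simp
    moreover have "up (down F) $ S = (\<Sum>j\<in>S. F $ S + (\<Sum>i\<in>-S. F $ insert i (S - {j})))"
      unfolding down_def up_def vec_lambda_beta
    proof (rule sum.cong)
      fix j assume j: "j \<in> S"
      then have "- (S - {j}) = insert j (-S)"
        by auto
      then show "(\<Sum>i\<in>-(S - {j}). F $ insert i (S - {j})) = F $ S + (\<Sum>i\<in>-S. F $ insert i (S - {j}))"
        using j by (simp add: insert_absorb)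
    qed simp
    moreover have "(\<Sum>i\<in>-S. \<Sum>j\<in>S. F $ insert i (S - {j})) = (\<Sum>j\<in>S. \<Sum>i\<in>-S. F $ insert i (S - {j}))"
      by (rule sum.swap)
    moreover have "of_nat (card (-S)) = (of_nat CARD('n) - of_nat (card S) :: complex)"
      by (simp add: Compl_eq_Diff_UNIV card_Diff_subset of_nat_diff card_mono)
    \<comment> \<open>The weight determines the size of \<open>S\<close> only where \<open>F\<close>
      does not vanish; elsewhere the scalar term is zero.\<close>
    moreover have "F $ S \<noteq> 0 \<Longrightarrow> of_int w = (of_nat (card S) :: complex)"
      using assms by (metis level_def of_int_of_nat_eq)
    ultimately show ?thesis
      by (cases "F $ S = 0") (simp_all add: sum.distrib algebra_simps)
  qed
  then show ?thesis
    by (simp add: Finite_Cartesian_Product.vec_eq_iff del: of_int_diff)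
qed

section \<open>Squares of the two operators as sums over sets two levels away\<close>

lemma sum_ordered_pairs:
  fixes g :: "'a \<times> 'a \<Rightarrow> 'b" and h :: "'b \<Rightarrow> complex"
  assumes "finite P" "finite C" "g ` P \<subseteq> C"
    and "\<And>T. T \<in> C \<Longrightarrow> card {p \<in> P. g p = T} = 2"
  shows "(\<Sum>p\<in>P. h (g p)) = 2 * (\<Sum>T\<in>C. h T)"
proof -
  have "(\<Sum>p\<in>P. h (g p)) = (\<Sum>T\<in>C. \<Sum>p | p \<in> P \<and> g p = T. h (g p))"
    using assms(1-3) by (rule sum.group[symmetric])
  also have "\<dots> = (\<Sum>T\<in>C. 2 * h T)"
    using assms(4) by (intro sum.cong) auto
  finally show ?thesis
    by (simp add: sum_distrib_left)
qed

text \<open>The two elements of \<open>T - S\<close> can be added in either order, whence the factor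
  2. Half of the square of \<open>down\<close> thus has the shape of the lowering matrix.\<close>

lemma down_down:
  "down (down F) $ S = 2 * (\<Sum>T | S \<subseteq> T \<and> card T = card S + 2. F $ T)"
proof -
  let ?P = "SIGMA i:-S. - insert i S"
  let ?g = "\<lambda>(i, j). insert j (insert i S)"
  have "down (down F) $ S = (\<Sum>p\<in>?P. F $ ?g p)"
    by (simp add: down_def sum.Sigma split_def)
  also have "\<dots> = 2 * (\<Sum>T | S \<subseteq> T \<and> card T = card S + 2. F $ T)"
  proof (rule sum_ordered_pairs)
    fix T assume "T \<in> {T. S \<subseteq> T \<and> card T = card S + 2}"
    then have T: "S \<subseteq> T" "card (T - S) = 2"
      by (auto simp: card_Diff_subset)
    then obtain p q where "T - S = {p, q}" "p \<noteq> q"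
      by (auto simp: card_2_iff)
    with T(1) have pq: "T = insert p (insert q S)" "p \<notin> S" "q \<notin> S" "p \<noteq> q"
      by auto
    then have "{p \<in> ?P. ?g p = T} = {(p, q), (q, p)}"
      by (auto simp: insert_eq_iff doubleton_eq_iff)
    then show "card {p \<in> ?P. ?g p = T} = 2"
      using pq(4) by simp
  qed auto
  finally show ?thesis .
qed

lemma up_up:
  "up (up F) $ S = 2 * (\<Sum>T | T \<subseteq> S \<and> card S = card T + 2. F $ T)"
proof -
  let ?P = "SIGMA i:S. S - {i}"
  let ?g = "\<lambda>(i, j). S - {i} - {j}"
  have "up (up F) $ S = (\<Sum>p\<in>?P. F $ ?g p)"
    by (simp add: up_def sum.Sigma split_def)
  also have "\<dots> = 2 * (\<Sum>T | T \<subseteq> S \<and> card S = card T + 2. F $ T)"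
  proof (rule sum_ordered_pairs)
    show "?g ` ?P \<subseteq> {T. T \<subseteq> S \<and> card S = card T + 2}"
    proof (rule image_subsetI)
      fix p assume "p \<in> ?P"
      then obtain i j where p: "p = (i, j)" and ij: "i \<in> S" "j \<in> S" "j \<noteq> i"
        by auto
      \<comment> \<open>\<open>S\<close> arises from \<open>Z\<close> by two insertions of new
        elements, which gives its size.\<close>
      define Z where "Z = S - {i} - {j}"
      have "S = insert i (insert j Z)" "i \<notin> Z" "j \<notin> Z"
        using ij by (auto simp: Z_def)
      with ij(3) have "Z \<subseteq> S \<and> card S = card Z + 2"
        by auto
      then show "?g p \<in> {T. T \<subseteq> S \<and> card S = card T + 2}"
        by (simp add: p Z_def)
    qed
    fix T assume "T \<in> {T. T \<subseteq> S \<and> card S = card T + 2}"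
    then have T: "T \<subseteq> S" "card (S - T) = 2"
      by (auto simp: card_Diff_subset)
    then obtain p q where "S - T = {p, q}" "p \<noteq> q"
      by (auto simp: card_2_iff)
    with T(1) have pq: "S = insert p (insert q T)" "p \<notin> T" "q \<notin> T" "p \<noteq> q"
      by auto
    then have "{p \<in> ?P. ?g p = T} = {(p, q), (q, p)}"
      by auto
    then show "card {p \<in> ?P. ?g p = T} = 2"
      using pq(4) by simp
  qed auto
  finally show ?thesis .
qed

section \<open>Commutation rules that rewrite products of the operators through
  \<open>ud\<close>\<close>

lemma up_up_down_down:
  fixes F :: "complex ^ ('n::finite set)"
  assumes "level w F" and "a = of_int (int CARD('n) - 2 * w)"
  shows "up (up (down (down F))) = up (down (up (down F))) - (a + 2) *s up (down F)"
proof -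
  have "down (up (down F)) = up (down (down F)) + (a + 2) *s down F"
    using down_up[OF level_down[OF assms(1)]] by (simp add: assms(2) algebra_simps)
  then show ?thesis
    by (simp only: up_add up_scale) (simp add: Finite_Cartesian_Product.vec_eq_iff algebra_simps)
qed

lemma down_down_up_up:
  fixes F :: "complex ^ ('n::finite set)"
  assumes "level w F" and "a = of_int (int CARD('n) - 2 * w)"
  shows "down (down (up (up F))) = down (up (down (up F))) + (a - 2) *s down (up F)"
proof -
  have "down (up (up F)) = up (down (up F)) + (a - 2) *s up F"
    using down_up[OF level_up[OF assms(1)]] by (simp add: assms(2) algebra_simps)
  then show ?thesis
    by (simp only: down_add down_scale)
qed

text \<open>\<open>up\<close> moves left past three copies of \<open>down\<close>, at weights
  \<open>w\<close>, \<open>w - 1\<close> and \<open>w - 2\<close>; the scalars \<open>a\<close>,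
  \<open>a + 2\<close> and \<open>a + 4\<close> add up. Two lowerings thus carry \<open>du\<close>
  over to \<open>ud\<close> plus a scalar.\<close>

lemma down_down_down_up:
  fixes F :: "complex ^ ('n::finite set)"
  assumes "level w F" and "a = of_int (int CARD('n) - 2 * w)"
  shows "down (down (down (up F))) = up (down (down (down F))) + (3 * a + 6) *s down (down F)"
proof -
  have 1: "down (up F) = up (down F) + a *s F"
    using down_up[OF assms(1)] by (simp add: assms(2))
  have 2: "down (up (down F)) = up (down (down F)) + (a + 2) *s down F"
    using down_up[OF level_down[OF assms(1)]] by (simp add: assms(2) algebra_simps)
  have 3: "down (up (down (down F))) = up (down (down (down F))) + (a + 4) *s down (down F)"
    using down_up[OF level_down[OF level_down[OF assms(1)]]] by (simp add: assms(2) algebra_simps)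
  show ?thesis
    by (simp only: 1 2 3 down_add down_scale) (simp add: Finite_Cartesian_Product.vec_eq_iff algebra_simps)
qed

text \<open>This is the uniform relation multiplied by 8: three factors 1/2 are cleared on the left
  and a single one on the right, which leaves the 4 there.\<close>

lemma boolean_lattice_relation:
  fixes F :: "complex ^ ('n::finite set)"
  assumes F: "level w F" and a: "a = of_int (int CARD('n) - 2 * (w - 2))"
    and "a \<noteq> 2"
  shows "((4 - a) / (2 * (a - 2))) *s up (up (down (down (down (down F)))))
       + down (down (up (up (down (down F)))))
       + (- a / (2 * (a - 2))) *s down (down (down (down (up (up F)))))
       = (4 * (- a * (a - 4))) *s down (down F)"
proof -
  \<comment> \<open>With \<open>N\<close> for \<open>ud\<close>, these are \<open>G\<close>,
    \<open>N G\<close> and \<open>N^2 G\<close>; each term of the relation is a combination of the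
    three.\<close>
  define G where "G = down (down F)"
  define X where "X = up (down G)"
  define Y where "Y = up (down X)"
  have G: "level (w - 2) G"
    using level_down[OF level_down[OF F]] by (simp add: G_def)
  have X: "level (w - 2) X"
    using level_up[OF level_down[OF G]] by (simp add: X_def)
  have M: "level w (down (up F))"
    using level_down[OF level_up[OF F]] by simp
  have aw: "a - 4 = of_int (int CARD('n) - 2 * w)"
    by (simp add: a)
  have 1: "up (up (down (down G))) = Y - (a + 2) *s X"
    using up_up_down_down[OF G a] by (simp add: Y_def X_def)
  have dG: "down (up G) = X + a *s G" and dX: "down (up X) = Y + a *s X"
    using down_up[OF G] down_up[OF X] by (simp_all add: Y_def X_def a)
  have 2: "down (down (up (up G))) = Y + a *s X + a *s (X + a *s G) + (a - 2) *s (X + a *s G)"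
    using down_down_up_up[OF G a]
    by (simp only: dG dX up_add up_scale down_add down_scale)
  have dM: "down (down (down (up F))) = X + (3 * a - 6) *s G"
    using down_down_down_up[OF F aw] by (simp add: X_def G_def algebra_simps)
  \<comment> \<open>\<open>down (up F)\<close> again has weight \<open>w\<close>, so the previous
    rule applies to it; this squares the factor \<open>N + 3 * a - 6\<close>.\<close>
  have dMM: "down (down (down (up (down (up F))))) = Y + (3 * a - 6) *s X + (3 * a - 6) *s (X + (3 * a - 6) *s G)"
    using down_down_down_up[OF M aw, unfolded dM]
    by (simp add: dM up_add up_scale up_diff down_add down_scale down_diff X_def[symmetric] Y_def[symmetric])
  have 3: "down (down (down (down (up (up F))))) =
      Y + (3 * a - 6) *s X + (3 * a - 6) *s (X + (3 * a - 6) *s G) + (a - 6) *s (X + (3 * a - 6) *s G)"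
    using arg_cong[OF down_down_up_up[OF F aw], of "\<lambda>F. down (down F)"]
    by (simp only: dM dMM down_add down_scale) simp
  have cancel: "(p / c) * y1 + y2 + (q / c) * y3 = r"
    if "c \<noteq> 0" "p * y1 + c * y2 + q * y3 = c * r" for p q c y1 y2 y3 r :: complex
    using that by (simp add: divide_simps mult.commute)
  have ring: "(4 - a) * (y - (a + 2) * x)
      + 2 * (a - 2) * (y + a * x + a * (x + a * g) + (a - 2) * (x + a * g))
      + - a * (y + (3 * a - 6) * x + (3 * a - 6) * (x + (3 * a - 6) * g) + (a - 6) * (x + (3 * a - 6) * g))
      = 2 * (a - 2) * (4 * (- a * (a - 4)) * g)" for x y g
    by (simp add: left_diff_distrib right_diff_distrib distrib_left distrib_right)
  have "2 * (a - 2) \<noteq> 0"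
    using assms(3) by simp
  then show ?thesis
    unfolding G_def[symmetric] 1 2 3 Finite_Cartesian_Product.vec_eq_iff
      vector_add_component vector_smult_component vector_minus_component
    by (intro allI cancel ring)
qed

section \<open>The halved cube as a family of even sets\<close>

definition bits :: "('n::finite) even_word \<Rightarrow> 'n set" where
  "bits y = {i. Rep_even_word y $ i}"

definition diff :: "('n::finite) even_word \<Rightarrow> 'n even_word \<Rightarrow> 'n set" where
  "diff y z = sym_diff (bits y) (bits z)"

text \<open>The inverse of \<open>diff x\<close> on sets of even size; the values at odd sets are
  unspecified.\<close>

definition shift :: "('n::finite) even_word \<Rightarrow> 'n set \<Rightarrow> 'n even_word" where
  "shift x T = Abs_even_word (\<chi> i. i \<in> sym_diff (bits x) T)"

lemma halved_cube_iff: "(y, z) \<in> halved_cube \<longleftrightarrow> card (diff y z) = 2"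
proof -
  have "{i. Rep_even_word y $ i \<noteq> Rep_even_word z $ i} = diff y z"
    by (auto simp: diff_def bits_def)
  then show ?thesis
    by (simp add: halved_cube_def)
qed

lemma card_sym_diff:
  fixes A B :: "'a::finite set"
  shows "card (sym_diff A B) + 2 * card (A \<inter> B) = card A + card B"
proof -
  have "card (sym_diff A B) = card (A - B) + card (B - A)"
    by (rule card_Un_disjoint) auto
  moreover have "card (A - B) + card (A \<inter> B) = card A" "card (B - A) + card (A \<inter> B) = card B"
    using card_Int_Diff[of A B] card_Int_Diff[of B A] by (simp_all add: Int_commute)
  ultimately show ?thesis
    by simp
qed

lemma even_card_sym_diff:
  fixes A B :: "'a::finite set"
  assumes "even (card A)" "even (card B)"
  shows "even (card (sym_diff A B))"
  using card_sym_diff[of A B] assms by (metis even_add dvd_triv_left)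

lemma even_card_bits: "even (card (bits y))"
  using Rep_even_word[of y] by (simp add: bits_def)

lemma even_card_diff: "even (card (diff y z))"
  unfolding diff_def by (intro even_card_sym_diff even_card_bits)

lemma bits_inject: "bits y = bits z \<longleftrightarrow> y = z"
proof
  assume "bits y = bits z"
  then have "Rep_even_word y $ i = Rep_even_word z $ i" for i
    by (auto simp: bits_def set_eq_iff)
  then show "y = z"
    by (simp add: Finite_Cartesian_Product.vec_eq_iff flip: Rep_even_word_inject)
qed simp

lemma diff_inject: "diff x y = diff x z \<longleftrightarrow> y = z"
proof -
  have "diff x y = diff x z \<longleftrightarrow> bits y = bits z"
    unfolding diff_def by blast
  then show ?thesis
    by (simp add: bits_inject)
qed

lemma diff_shift:
  assumes "even (card T)"
  shows "diff x (shift x T) = T"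
proof -
  have "bits (shift x T) = sym_diff (bits x) T"
  proof -
    let ?v = "\<chi> i. i \<in> sym_diff (bits x) T"
    have v: "{i. ?v $ i} = sym_diff (bits x) T"
      by auto
    then have "Rep_even_word (shift x T) = ?v"
      unfolding shift_def using even_card_sym_diff[OF even_card_bits assms]
      by (intro Abs_even_word_inverse) (simp only: mem_Collect_eq v)
    with v show ?thesis
      by (simp only: bits_def[of "shift x T"])
  qed
  then show ?thesis
    by (auto simp: diff_def)
qed

lemma shift_diff: "shift x (diff x y) = y"
  using diff_shift[OF even_card_diff[of x y], of x] by (simp only: diff_inject)

text \<open>\<open>bits x\<close> cancels, so adjacency of \<open>y\<close> and \<open>z\<close> can
  be read off from their sets relative to \<open>x\<close>.\<close>

lemma diff_cocycle: "diff y z = sym_diff (diff x y) (diff x z)"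
  by (auto simp: diff_def)

lemma diff_commute: "diff y z = diff z y"
  by (auto simp: diff_def)

text \<open>If the sizes differ by 2, the symmetric difference has size 2 exactly when the
  intersection is as large as the smaller set.\<close>

lemma adjacent_up_iff:
  "(y, z) \<in> halved_cube \<and> card (diff x z) = card (diff x y) + 2 \<longleftrightarrow>
     diff x y \<subseteq> diff x z \<and> card (diff x z) = card (diff x y) + 2"
proof -
  let ?A = "diff x y" and ?B = "diff x z"
  have "card (sym_diff ?A ?B) = 2 \<longleftrightarrow> ?A \<subseteq> ?B" if "card ?B = card ?A + 2"
  proof -
    have "card (sym_diff ?A ?B) = 2 \<longleftrightarrow> card (?A \<inter> ?B) = card ?A"
      using card_sym_diff[of ?A ?B] that by linarith
    also have "\<dots> \<longleftrightarrow> ?A \<inter> ?B = ?A"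
      by (metis card_subset_eq finite inf_le1)
    finally show ?thesis
      by blast
  qed
  then show ?thesis
    by (auto simp: halved_cube_iff diff_cocycle[of y z x])
qed

section \<open>Paths, distances from the base vertex, and the diameter\<close>

definition ascending_edges :: "('n::finite) even_word \<Rightarrow> 'n even_word rel" where
  "ascending_edges x = {(y, z) \<in> halved_cube. card (diff x z) = card (diff x y) + 2}"

text \<open>Two elements of \<open>diff x y\<close> are removed at a time; the intermediate sets
  stay even and so come from vertices.\<close>

lemma ascending_path:
  "card (diff x y) = 2 * k \<Longrightarrow> (x, y) \<in> ascending_edges x ^^ k"
proof (induction k arbitrary: y)
  case 0
  then have "diff x y = {}"
    by simp
  then have "x = y"
    by (metis diff_inject diff_def Diff_cancel Un_absorb)
  then show ?case
    by simp
next
  case (Suc k)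
  then have "2 \<le> card (diff x y)"
    by simp
  then obtain U where U: "U \<subseteq> diff x y" "card U = 2"
    by (meson obtain_subset_with_card_n)
  have card: "card (diff x y - U) = 2 * k"
    using Suc.prems U by (simp add: card_Diff_subset)
  define z where "z = shift x (diff x y - U)"
  have z: "diff x z = diff x y - U"
    using card by (simp add: z_def diff_shift)
  then have "(x, z) \<in> ascending_edges x ^^ k"
    using card by (intro Suc.IH) simp
  moreover have "(z, y) \<in> ascending_edges x"
    using adjacent_up_iff[of z y x] z card Suc.prems
    by (simp add: ascending_edges_def)
  ultimately show ?case
    by auto
qed

lemma card_diff_le_path:
  assumes "G \<subseteq> halved_cube" "(x, y) \<in> G ^^ k"
  shows "card (diff x y) \<le> 2 * k"
  using assms(2)
proof (induction k arbitrary: y)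
  case (Suc k)
  then obtain z where z: "(x, z) \<in> G ^^ k" "(z, y) \<in> G"
    by auto
  have "card (diff x y) \<le> card (diff x z \<union> diff z y)"
    by (rule card_mono) (auto simp: diff_def)
  also have "\<dots> \<le> card (diff x z) + card (diff z y)"
    by (rule card_Un_le)
  also have "\<dots> \<le> 2 * k + 2"
    using Suc.IH[OF z(1)] z(2) assms(1) halved_cube_iff[of z y] by auto
  finally show ?case
    by simp
qed (simp add: diff_def)

lemma relpow_mono:
  fixes R S :: "'a rel"
  assumes "R \<subseteq> S"
  shows "R ^^ k \<subseteq> S ^^ k"
  using assms by (induction k) auto

text \<open>Ascending paths attain the bound that each edge changes only two coordinates. All graphs
  between the ascending edges and the halved cube therefore share their distances from
  \<open>x\<close>.\<close>

lemma graph_dist_eq: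
  assumes "ascending_edges x \<subseteq> G" "G \<subseteq> halved_cube"
  shows "graph_dist G x y = card (diff x y) div 2"
  unfolding graph_dist_def
proof (rule Least_equality)
  show "(x, y) \<in> G ^^ (card (diff x y) div 2)"
    using ascending_path[of x y "card (diff x y) div 2"] even_card_diff[of x y]
      relpow_mono[OF assms(1)] by fastforce
next
  fix k assume "(x, y) \<in> G ^^ k"
  then show "card (diff x y) div 2 \<le> k"
    using card_diff_le_path[OF assms(2)] by fastforce
qed

lemma ascending_edges_subset: "ascending_edges x \<subseteq> halved_cube"
  by (auto simp: ascending_edges_def)

lemma ascending_edges_subset_bipartite_part:
  "ascending_edges x \<subseteq> bipartite_part halved_cube x"
  by (auto simp: ascending_edges_def bipartite_part_def graph_dist_eq[OF ascending_edges_subset])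

lemma sym_halved_cube: "sym halved_cube"
  by (auto simp: sym_def halved_cube_iff diff_commute)

lemma sym_bipartite_part: "sym G \<Longrightarrow> sym (bipartite_part G x)"
  by (auto simp: sym_def bipartite_part_def)

lemma graph_diameter_halved_cube:
  assumes "CARD('n) = 2 * D + 1"
  shows "graph_diameter (halved_cube :: ('n::finite) even_word rel) = D"
  unfolding graph_diameter_def
proof (rule Max_eqI)
  let ?G = "halved_cube :: 'n even_word rel"
  have dist: "graph_dist ?G x y = card (diff x y) div 2" for x y
    using graph_dist_eq[OF ascending_edges_subset] by blast
  have "{graph_dist ?G x y |x y. True} = (\<lambda>(x, y). graph_dist ?G x y) ` UNIV"
    by auto
  then show "finite {graph_dist ?G x y |x y. True}"
    by simp
  show "d \<le> D" if d: "d \<in> {graph_dist ?G x y |x y. True}" for d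
  proof -
    obtain x y where "d = graph_dist ?G x y"
      using d by blast
    then have "d = card (diff x y) div 2"
      by (simp only: dist)
    moreover have "card (diff x y) \<le> 2 * D + 1"
      using card_mono[of UNIV "diff x y"] assms by simp
    ultimately show ?thesis
      by simp
  qed
  \<comment> \<open>All coordinates but one form a set of even size, which is the difference set of
    some vertex from any given one.\<close>
  obtain T :: "'n set" where T: "card T = 2 * D"
    using obtain_subset_with_card_n[of "2 * D" "UNIV :: 'n set"] assms by auto
  fix x :: "'n even_word"
  have "graph_dist ?G x (shift x T) = D"
    using T by (simp add: dist diff_shift)
  then show "D \<in> {graph_dist ?G x y |x y. True}"
    by blast
qed

section \<open>Entries of the lowering and raising matrices\<close>

lemma dual_idempotent_mult_mult:
  "(dual_idempotent G x i ** M ** dual_idempotent G x j) $ y $ z =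
     (if graph_dist G x y = i \<and> graph_dist G x z = j then M $ y $ z else 0)"
proof -
  have "(\<Sum>k\<in>UNIV. (if y = k \<and> graph_dist G x y = i then 1 else 0) * M $ k $ w) =
      (\<Sum>k\<in>UNIV. if y = k then if graph_dist G x y = i then M $ k $ w else 0 else 0)" for w
    by (rule sum.cong) auto
  then have 1: "(dual_idempotent G x i ** M) $ y $ w = (if graph_dist G x y = i then M $ y $ w else 0)" for w
    by (simp add: dual_idempotent_def matrix_matrix_mult_def)
  have "(dual_idempotent G x i ** M ** dual_idempotent G x j) $ y $ z =
      (\<Sum>k\<in>UNIV. (dual_idempotent G x i ** M) $ y $ k * dual_idempotent G x j $ k $ z)"
    by (simp add: matrix_matrix_mult_def)
  also have "\<dots> = (\<Sum>k\<in>UNIV. if k = z then if graph_dist G x z = j then (dual_idempotent G x i ** M) $ y $ z else 0 else 0)"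
    by (rule sum.cong) (auto simp: dual_idempotent_def)
  finally show ?thesis
    by (simp add: 1)
qed

text \<open>The assumptions fit both the halved cube, for which the displayed relation is claimed,
  and its bipartite part, on which the uniform structure lives. One argument then serves
  both.\<close>

locale halved_cube_spanning =
  fixes G :: "('n::finite) even_word rel" and x :: "'n even_word" and D :: nat
  assumes ascending: "ascending_edges x \<subseteq> G"
    and subset: "G \<subseteq> halved_cube"
    and sym: "sym G"
    and card_UNIV: "CARD('n) = 2 * D + 1"
begin

lemma two_mult_dist: "2 * graph_dist G x y = card (diff x y)"
  using graph_dist_eq[OF ascending subset] even_card_diff[of x y] by simp

lemma dist_le: "graph_dist G x y \<le> D"
  using two_mult_dist[of y] card_mono[of UNIV "diff x y"] card_UNIV by simp

lemma edge_iff: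
  assumes "graph_dist G x z = graph_dist G x y + 1"
  shows "(y, z) \<in> G \<longleftrightarrow> diff x y \<subseteq> diff x z"
proof -
  have card: "card (diff x z) = card (diff x y) + 2"
    using assms by (simp flip: two_mult_dist)
  then have "(y, z) \<in> G \<longleftrightarrow> (y, z) \<in> halved_cube"
    using ascending subset by (auto simp: ascending_edges_def)
  then show ?thesis
    using adjacent_up_iff[of y z x] card by simp
qed

text \<open>The relation does not mention \<open>G\<close>, so all graphs of this kind have the same
  lowering and raising matrices.\<close>

definition covers :: "'n even_word \<Rightarrow> 'n even_word \<Rightarrow> bool" where
  "covers y z \<longleftrightarrow> diff x y \<subseteq> diff x z \<and> card (diff x z) = card (diff x y) + 2"

lemma covers_iff:
  "covers y z \<longleftrightarrow> (y, z) \<in> G \<and> graph_dist G x z = graph_dist G x y + 1"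
  using edge_iff[of z y] two_mult_dist[of y] two_mult_dist[of z]
  unfolding covers_def by auto

lemma lowering_entry: "lowering_matrix D G x $ y $ z = (if covers y z then 1 else 0)"
proof -
  \<comment> \<open>Only the summand at the distance of \<open>z\<close> survives. This index is at
    least 1 if \<open>covers y z\<close> holds, and at most \<open>D\<close> in any case.\<close>
  have "lowering_matrix D G x $ y $ z = (\<Sum>i = 1..D. if i = graph_dist G x z then
      if covers y z then 1 else 0 else 0)"
    unfolding lowering_matrix_def sum_component
    by (rule sum.cong) (auto simp: dual_idempotent_mult_mult adjacency_matrix_def covers_iff)
  then show ?thesis
    using dist_le[of z] by (auto simp: covers_iff)
qed

lemma raising_entry: "raising_matrix D G x $ y $ z = (if covers z y then 1 else 0)"
proof -
  have "(y, z) \<in> G \<longleftrightarrow> (z, y) \<in> G"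
    using sym by (auto dest: symD)
  then have "raising_matrix D G x $ y $ z = (\<Sum>i = 0..<D. if i = graph_dist G x z then
      if covers z y then 1 else 0 else 0)"
    unfolding raising_matrix_def sum_component
    by (intro sum.cong) (auto simp: dual_idempotent_mult_mult adjacency_matrix_def covers_iff)
  then show ?thesis
    using dist_le[of y] by (auto simp: covers_iff)
qed

text \<open>Vertices correspond to even sets, but a single \<open>down\<close> or \<open>up\<close>
  passes through odd ones. Extension by zero makes both operators available.\<close>

definition lift :: "complex ^ 'n even_word \<Rightarrow> complex ^ 'n set" where
  "lift v = (\<chi> T. if even (card T) then v $ shift x T else 0)"

lemma lift_diff: "lift v $ diff x y = v $ y"
  by (simp add: lift_def even_card_diff shift_diff)

lemma lift_inject: "lift v = lift w \<longleftrightarrow> v = w"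
  by (metis lift_diff Finite_Cartesian_Product.vec_eq_iff)

lemma lift_add: "lift (v + w) = lift v + lift w"
  by (simp add: lift_def Finite_Cartesian_Product.vec_eq_iff)

lemma lift_scale: "lift (c *s v) = c *s lift v"
  by (simp add: lift_def Finite_Cartesian_Product.vec_eq_iff)

text \<open>\<open>diff x\<close> is a bijection from the vertices to the sets of even size.\<close>

lemma sum_lift:
  assumes "\<And>T. P T \<Longrightarrow> even (card T)"
  shows "(\<Sum>T | P T. lift v $ T) = (\<Sum>z | P (diff x z). v $ z)"
proof (rule sum.reindex_cong)
  show "inj_on (diff x) {z. P (diff x z)}"
    by (auto simp: inj_on_def diff_inject)
  show "{T. P T} = diff x ` {z. P (diff x z)}"
    using assms by (auto simp: image_iff) (metis diff_shift)
qed (simp add: lift_diff)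

lemma lift_lowering: "lift (lowering_matrix D G x *v v) = (1 / 2) *s down (down (lift v))"
proof -
  have "lift (lowering_matrix D G x *v v) $ S = (1 / 2) * down (down (lift v)) $ S" for S
  proof (cases "even (card S)")
    case False
    \<comment> \<open>Sets two levels above an odd \<open>S\<close> are odd, so both sides
      vanish.\<close>
    then have "(\<Sum>T | S \<subseteq> T \<and> card T = card S + 2. lift v $ T) = 0"
      by (intro sum.neutral) (simp add: lift_def)
    then show ?thesis
      using False by (simp add: down_down lift_def)
  next
    case True
    then have "lift (lowering_matrix D G x *v v) $ S = (\<Sum>z\<in>UNIV. if covers (shift x S) z then v $ z else 0)"
      by (simp add: lift_def matrix_vector_mult_def lowering_entry if_distrib[of "\<lambda>c. c * _"] cong: if_cong)
    also have "\<dots> = (\<Sum>z | covers (shift x S) z. v $ z)"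
      by (simp flip: sum.inter_filter)
    also have "\<dots> = (\<Sum>T | S \<subseteq> T \<and> card T = card S + 2. lift v $ T)"
      using True by (subst sum_lift) (simp_all add: covers_def[abs_def] diff_shift)
    finally show ?thesis
      by (simp add: down_down)
  qed
  then show ?thesis
    by (simp add: Finite_Cartesian_Product.vec_eq_iff)
qed

lemma lift_raising: "lift (raising_matrix D G x *v v) = (1 / 2) *s up (up (lift v))"
proof -
  have "lift (raising_matrix D G x *v v) $ S = (1 / 2) * up (up (lift v)) $ S" for S
  proof (cases "even (card S)")
    case False
    then have "(\<Sum>T | T \<subseteq> S \<and> card S = card T + 2. lift v $ T) = 0"
      by (intro sum.neutral) (auto simp: lift_def)
    then show ?thesis
      using False by (simp add: up_up lift_def)
  next
    case True
    then have "lift (raising_matrix D G x *v v) $ S = (\<Sum>z\<in>UNIV. if covers z (shift x S) then v $ z else 0)"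
      by (simp add: lift_def matrix_vector_mult_def raising_entry if_distrib[of "\<lambda>c. c * _"] cong: if_cong)
    also have "\<dots> = (\<Sum>z | covers z (shift x S). v $ z)"
      by (simp flip: sum.inter_filter)
    also have "\<dots> = (\<Sum>T | T \<subseteq> S \<and> card S = card T + 2. lift v $ T)"
      using True by (subst sum_lift) (auto simp: covers_def diff_shift)
    finally show ?thesis
      by (simp add: up_up)
  qed
  then show ?thesis
    by (simp add: Finite_Cartesian_Product.vec_eq_iff)
qed

lemma level_lift:
  assumes "v \<in> range (\<lambda>w. dual_idempotent G x i *v w)"
  shows "level (2 * int i) (lift v)"
  unfolding level_def
proof (intro allI impI)
  fix T assume T: "lift v $ T \<noteq> 0"
  then have even: "even (card T)" and v: "v $ shift x T \<noteq> 0"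
    by (auto simp: lift_def split: if_splits)
  from assms obtain w where "v = dual_idempotent G x i *v w"
    by blast
  with v have "graph_dist G x (shift x T) = i"
    by (auto simp: dual_idempotent_def matrix_vector_mult_def elim: sum.not_neutral_contains_not_neutral split: if_splits)
  then show "int (card T) = 2 * int i"
    using two_mult_dist[of "shift x T"] even by (simp add: diff_shift)
qed

text \<open>\<open>em\<close> is left free at \<open>i = 1\<close> and \<open>ep\<close> at
  \<open>i = D\<close>, since the terms that they multiply vanish there. This accommodates the value
  0 prescribed at the two ends.\<close>

lemma uniform_relation:
  fixes a em ep :: complex
  assumes i: "1 \<le> i" "i \<le> D"
    and a: "a = 2 * of_nat D + 5 - 4 * of_nat i"
    and em: "i \<noteq> 1 \<Longrightarrow> em = (4 - a) / (2 * (a - 2))"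
    and ep: "i \<noteq> D \<Longrightarrow> ep = - a / (2 * (a - 2))"
  shows "uniform_relation D G x i em ep (- a * (a - 4))"
  unfolding uniform_relation_def Let_def
proof
  fix v assume v: "v \<in> range (\<lambda>w. dual_idempotent G x i *v w)"
  let ?L = "lowering_matrix D G x" and ?R = "raising_matrix D G x"
  define F where "F = lift v"
  have F: "level (2 * int i) F"
    unfolding F_def by (rule level_lift[OF v])
  have a_int: "a = of_int (int CARD('n) - 2 * (2 * int i - 2))"
    by (simp add: a card_UNIV)
  have "a - 2 = of_int (2 * int D + 3 - 4 * int i)"
    by (simp add: a)
  \<comment> \<open>The number is odd.\<close>
  moreover have "2 * int D + 3 - 4 * int i \<noteq> 0"
    by presburger
  ultimately have "a \<noteq> 2"
    by (metis of_int_eq_0_iff right_minus_eq)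
  have rel: "((4 - a) / (2 * (a - 2))) *s up (up (down (down (down (down F)))))
       + down (down (up (up (down (down F)))))
       + (- a / (2 * (a - 2))) *s down (down (down (down (up (up F)))))
       = (4 * (- a * (a - 4))) *s down (down F)"
    by (rule boolean_lattice_relation[OF F a_int \<open>a \<noteq> 2\<close>])
  have em': "((4 - a) / (2 * (a - 2))) *s up (up (down (down (down (down F)))))
      = em *s up (up (down (down (down (down F)))))"
  proof (cases "i = 1")
    case True
    \<comment> \<open>Three lowerings from weight 2 lead to weight -1.\<close>
    have "level (2 * int i - 1 - 1 - 1) (down (down (down F)))"
      by (intro level_down F)
    then have "down (down (down F)) = 0"
      by (rule level_eq_0) (simp add: True)
    then have "up (up (down (down (down (down F))))) = 0"
      by (simp add: down_def up_def Finite_Cartesian_Product.vec_eq_iff)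
    then show ?thesis
      by simp
  qed (simp add: em)
  have ep': "(- a / (2 * (a - 2))) *s down (down (down (down (up (up F)))))
      = ep *s down (down (down (down (up (up F)))))"
  proof (cases "i = D")
    case True
    \<comment> \<open>The weight \<open>2 * D + 2\<close> exceeds the number
      \<open>2 * D + 1\<close> of coordinates.\<close>
    have "level (2 * int i + 1 + 1) (up (up F))"
      by (intro level_up F)
    then have "up (up F) = 0"
      by (rule level_eq_0) (simp add: True card_UNIV)
    then have "down (down (down (down (up (up F))))) = 0"
      by (simp add: down_def Finite_Cartesian_Product.vec_eq_iff)
    then show ?thesis
      by simp
  qed (simp add: ep)
  \<comment> \<open>The relation is compared after the injective map \<open>lift\<close>, where each
    of the three matrices in a product contributes a factor 1/2.\<close>
  have "lift (em *s ((?R ** ?L ** ?L) *v v) + (?L ** ?R ** ?L) *v v + ep *s ((?L ** ?L ** ?R) *v v))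
      = (1 / 8) *s (em *s up (up (down (down (down (down F)))))
       + down (down (up (up (down (down F)))))
       + ep *s down (down (down (down (up (up F))))))"
    by (simp add: lift_add lift_scale lift_lowering lift_raising F_def[symmetric]
        down_scale up_scale Finite_Cartesian_Product.vec_eq_iff distrib_left
        flip: matrix_vector_mul_assoc)
  also have "\<dots> = (1 / 8) *s ((4 * (- a * (a - 4))) *s down (down F))"
    using rel unfolding em' ep' by (rule arg_cong)
  also have "\<dots> = lift ((- a * (a - 4)) *s (?L *v v))"
    unfolding lift_scale lift_lowering F_def by (simp add: Finite_Cartesian_Product.vec_eq_iff)
  finally show "em *s ((?R ** ?L ** ?L) *v v) + (?L ** ?R ** ?L) *v v + ep *s ((?L ** ?L ** ?R) *v v)
      = (- a * (a - 4)) *s (?L *v v)"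
    by (simp only: lift_inject)
qed

end

section \<open>Nonsingularity of the parameter matrix\<close>

text \<open>The recurrence says that \<open>a k\<close> times the next difference of
  \<open>y\<close> is \<open>a (Suc k)\<close> times the current one, so the differences are
  proportional to the \<open>a k\<close>. They telescope to 0, and the nonzero sum of the
  \<open>a k\<close> forces \<open>y 1 = 0\<close>.\<close>

lemma second_order_recurrence_trivial:
  fixes a y :: "nat \<Rightarrow> complex"
  assumes a: "\<And>k. a k \<noteq> 0"
    and y: "y 0 = 0" "y (Suc m) = 0"
    and rec: "\<And>k. k < m \<Longrightarrow>
      (a k + a (Suc k)) * y (Suc k) = a (Suc k) * y k + a k * y (Suc (Suc k))"
    and sum: "(\<Sum>k\<le>m. a k) \<noteq> 0"
    and "k \<le> Suc m"
  shows "y k = 0"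
proof -
  \<comment> \<open>The factor of proportionality is \<open>y 1 / a 0\<close>, because
    \<open>y 0 = 0\<close>; the equation is kept free of division.\<close>
  have step: "a 0 * (y (Suc k) - y k) = a k * y 1" if "k \<le> m" for k
    using that
  proof (induction k)
    case 0
    show ?case
      by (simp add: y)
  next
    case (Suc k)
    have "a k * (y (Suc (Suc k)) - y (Suc k)) = a (Suc k) * (y (Suc k) - y k)"
      using rec[of k] Suc.prems by (simp add: algebra_simps)
    then have "a k * (a 0 * (y (Suc (Suc k)) - y (Suc k))) = a (Suc k) * (a 0 * (y (Suc k) - y k))"
      by (simp only: mult.left_commute[of _ "a 0"])
    also have "\<dots> = a k * (a (Suc k) * y 1)"
      using Suc by simp
    finally show ?case
      using a by simp
  qed
  have total: "a 0 * y k = (\<Sum>j<k. a j) * y 1" if "k \<le> Suc m" for k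
    using that
  proof (induction k)
    case (Suc k)
    have "a 0 * y (Suc k) = a 0 * (y (Suc k) - y k) + a 0 * y k"
      by (simp add: algebra_simps)
    then show ?case
      using Suc step[of k] by (simp add: algebra_simps)
  qed (simp add: y)
  have "(\<Sum>j\<le>m. a j) * y 1 = 0"
    using total[of "Suc m"] by (simp add: y lessThan_Suc_atMost)
  then have "y 1 = 0"
    using sum by simp
  then show ?thesis
    using total[OF assms(6)] a by simp
qed

lemma sum_linear: "(\<Sum>k\<le>m. c - 4 * of_nat k) = of_nat (m + 1) * (c - 2 * of_nat m :: complex)"
  by (induction m) (simp_all add: algebra_simps)

text \<open>In the application \<open>a (p + 1) = a p - 4\<close>, so \<open>4 - a p\<close> is
  \<open>- a (p + 1)\<close> and the denominator is \<open>a p + a (p + 1)\<close>. The first and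
  last rows follow the same formula, as \<open>e_minus\<close> and \<open>e_plus\<close> cut off the
  ends.\<close>

definition parameters :: "(nat \<Rightarrow> complex) \<Rightarrow> nat \<Rightarrow> nat \<Rightarrow> complex" where
  "parameters a p q =
     (if q = p then 1
      else if q + 1 = p then (4 - a p) / (2 * (a p - 2))
      else if q = p + 1 then - a p / (2 * (a p - 2)) else 0)"

lemma det_parameters_nonzero:
  fixes c :: int and a :: "nat \<Rightarrow> complex"
  assumes c: "odd c" and a: "\<And>k. a k = of_int (c - 4 * int k)"
  shows "Determinant.det (Matrix.mat m m (\<lambda>(i, j). parameters a (s + i) (s + j))) \<noteq> 0"
proof
  let ?A = "Matrix.mat m m (\<lambda>(i, j). parameters a (s + i) (s + j))"
  assume "Determinant.det ?A = 0"
  then obtain v where v: "v \<in> carrier_vec m" "v \<noteq> 0\<^sub>v m" "?A *\<^sub>v v = 0\<^sub>v m"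
    using det_0_iff_vec_prod_zero_field[of ?A m] by auto
  \<comment> \<open>The null vector is shifted by one and padded with zeros, so that the first and
    last rows obey the same recurrence as the others.\<close>
  define y where "y k = (if k = 0 \<or> k = Suc m then 0 else vec_index v (k - 1))" for k
  have odd_nonzero: "of_int (d :: int) \<noteq> (0 :: complex)" if "odd d" for d
    using that by (metis even_zero of_int_eq_0_iff)
  have rec: "(a (s + k) + a (s + Suc k)) * y (Suc k)
      = a (s + Suc k) * y k + a (s + k) * y (Suc (Suc k))" if k: "k < m" for k
  proof -
    define b where "b = a (s + k)"
    have b: "a (s + Suc k) = b - 4" "b - 2 \<noteq> 0"
      using odd_nonzero[of "c - 4 * int (s + k) - 2"] c by (simp_all add: b_def a)
    let ?e = "(4 - b) / (2 * (b - 2))" and ?f = "- b / (2 * (b - 2))"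
    have "0 = vec_index (?A *\<^sub>v v) k"
      unfolding v(3) using k by simp
    also have "\<dots> = (\<Sum>j\<in>{0..<m}. parameters a (s + k) (s + j) * y (Suc j))"
      using v(1) k by (simp add: scalar_prod_def y_def)
    also have "\<dots> = (\<Sum>j\<in>{0..<m}. (if j = k then y (Suc k) else 0)
        + (if Suc j = k then ?e * y k else 0) + (if j = Suc k then ?f * y (Suc (Suc k)) else 0))"
      by (rule sum.cong) (auto simp: parameters_def b_def)
    also have "\<dots> = y (Suc k) + ?e * y k + ?f * y (Suc (Suc k))"
    proof -
      \<comment> \<open>For \<open>k = 0\<close> no index \<open>j\<close> qualifies, and the right
        side is zero because \<open>y 0 = 0\<close>. The last row is treated alike in the next
        sum.\<close>
      have "(\<Sum>j\<in>{0..<m}. if Suc j = k then ?e * y k else 0) = ?e * y k"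
        using k by (cases k) (simp_all add: y_def)
      moreover have "(\<Sum>j\<in>{0..<m}. if j = Suc k then ?f * y (Suc (Suc k)) else 0) = ?f * y (Suc (Suc k))"
        using k by (auto simp: y_def)
      ultimately show ?thesis
        using k by (simp add: sum.distrib)
    qed
    finally have row: "y (Suc k) + ?e * y k + ?f * y (Suc (Suc k)) = 0"
      by simp
    have clear: "c * y1 + p * y0 + q * y2 = 0"
      if "c \<noteq> 0" "y1 + p / c * y0 + q / c * y2 = 0" for c p q y0 y1 y2 :: complex
      using that by (simp add: field_simps)
    have "2 * (b - 2) * y (Suc k) + (4 - b) * y k + - b * y (Suc (Suc k)) = 0"
      by (rule clear[OF _ row]) (use b(2) in simp)
    then show ?thesis
      unfolding b b_def[symmetric] by (simp add: algebra_simps)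
  qed
  \<comment> \<open>The sum is the number of its terms times their mean, an odd integer.\<close>
  have "(\<Sum>k\<le>m. a (s + k)) = of_nat (m + 1) * of_int (c - 4 * int s - 2 * int m)"
    using sum_linear[of "of_int (c - 4 * int s)" m] by (simp add: a algebra_simps)
  moreover have "odd (c - 4 * int s - 2 * int m)"
    using c by simp
  ultimately have sum: "(\<Sum>k\<le>m. a (s + k)) \<noteq> 0"
    using odd_nonzero by (metis Suc_eq_plus1 mult_eq_0_iff of_nat_neq_0)
  have "y k = 0" if "k \<le> Suc m" for k
  proof (rule second_order_recurrence_trivial[where a = "\<lambda>k. a (s + k)"])
    show "a (s + k) \<noteq> 0" for k
      unfolding a by (rule odd_nonzero) (use c in simp)
  qed (use rec sum that in \<open>simp_all add: y_def\<close>)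
  then have "vec_index v k = 0" if "k < m" for k
    using that by (metis Suc_leI Suc_le_mono diff_Suc_1 le_SucI nat.distinct(1) nat.inject less_irrefl y_def)
  with v(1) have "v = 0\<^sub>v m"
    by (intro eq_vecI) auto
  with v(2) show False ..
qed

section \<open>The uniform structure\<close>

theorem theorem9p6:
  fixes n D :: nat
    and x :: "('n::finite) even_word"
    and em ep f :: "nat \<Rightarrow> complex"
  assumes "CARD('n) = n" and "n \<ge> 7" and "odd n"
    and "D = (n - 1) div 2"
    and "em 1 = 0"
    and "\<And>i. 2 \<le> i \<Longrightarrow> i \<le> D \<Longrightarrow>
           em i = (4 * of_nat i - 1 - 2 * of_nat D) / (6 - 8 * of_nat i + 4 * of_nat D)"
    and "\<And>i. 1 \<le> i \<Longrightarrow> i \<le> D - 1 \<Longrightarrow>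
           ep i = (4 * of_nat i - 5 - 2 * of_nat D) / (6 - 8 * of_nat i + 4 * of_nat D)"
    and "ep D = 0"
    and "\<And>i. 1 \<le> i \<Longrightarrow> i \<le> D \<Longrightarrow>
           f i = - (4 * of_nat i - 5) * (4 * of_nat i - 1)
                 + (16 * of_nat i - 12) * of_nat D - 4 * of_nat D ^ 2"
  shows "graph_diameter (halved_cube :: 'n even_word rel) = D \<and>
         (\<forall>i\<in>{1..D}. uniform_relation D halved_cube x i (em i) (ep i) (f i)) \<and>
         supports_strongly_uniform_structure halved_cube x"
proof -
  have n: "CARD('n) = 2 * D + 1"
    using assms(1,3,4) by simp
  let ?H = "halved_cube :: 'n even_word rel"
  let ?B = "bipartite_part ?H x"
  interpret H: halved_cube_spanning ?H x D
    by unfold_locales (use ascending_edges_subset sym_halved_cube n in auto)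
  interpret B: halved_cube_spanning ?B x D
    by unfold_locales
      (use ascending_edges_subset_bipartite_part sym_bipartite_part[OF sym_halved_cube] n
       in \<open>auto simp: bipartite_part_def\<close>)
  define a :: "nat \<Rightarrow> complex" where "a i = of_int (2 * int D + 5 - 4 * int i)" for i
  have a: "a i = 2 * of_nat D + 5 - 4 * of_nat i" for i
    by (simp add: a_def)
  have denominator: "6 - 8 * of_nat i + 4 * of_nat D = 2 * (a i - 2)" for i
    by (simp add: a)
  have em: "em i = (4 - a i) / (2 * (a i - 2))" if "2 \<le> i" "i \<le> D" for i
    unfolding assms(6)[OF that] denominator by (simp add: a)
  have ep: "ep i = - a i / (2 * (a i - 2))" if "1 \<le> i" "i \<le> D - 1" for i
    unfolding assms(7)[OF that] denominator by (simp add: a)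
  have f: "f i = - a i * (a i - 4)" if "1 \<le> i" "i \<le> D" for i
    unfolding assms(9)[OF that] a
    by (simp add: power2_eq_square left_diff_distrib right_diff_distrib distrib_left distrib_right)
  \<comment> \<open>Each \<open>a i\<close> is an odd integer and stays odd when \<open>k\<close> is
    added. The shifts 0, -2 and -4 cover all numerators and denominators.\<close>
  have odd_nonzero: "a i + of_int k \<noteq> 0" if "even k" for i and k :: int
  proof -
    have "2 * int D + 5 - 4 * int i + k \<noteq> 0"
      using that by presburger
    then show ?thesis
      unfolding a_def of_int_add[symmetric] of_int_eq_0_iff .
  qed
  have nonzero: "a i \<noteq> 0" "a i - 2 \<noteq> 0" "4 - a i \<noteq> 0" for i
    using odd_nonzero[of 0 i] odd_nonzero[of "-2" i] odd_nonzero[of "-4" i] by auto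
  let ?U = "parameters a"
  have minus: "e_minus ?U i = (4 - a i) / (2 * (a i - 2))" if "2 \<le> i" for i
    using that by (cases i) (simp_all add: e_minus_def parameters_def)
  have plus: "e_plus D ?U i = - a i / (2 * (a i - 2))" if "i \<noteq> D" for i
    using that by (simp add: e_plus_def parameters_def)
  have "\<forall>i\<in>{1..D}. uniform_relation D ?H x i (em i) (ep i) (f i)"
  proof
    fix i assume i: "i \<in> {1..D}"
    have "uniform_relation D ?H x i (em i) (ep i) (- a i * (a i - 4))"
      by (rule H.uniform_relation) (use i em ep a in auto)
    then show "uniform_relation D ?H x i (em i) (ep i) (f i)"
      using i by (simp only: f atLeastAtMost_iff)
  qed
  moreover have "strongly_uniform_structure D ?B x ?U f"
    unfolding strongly_uniform_structure_def uniform_structure_def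
  proof (intro conjI ballI)
    show "parameter_matrix D ?U"
      unfolding parameter_matrix_def
    proof (intro conjI ballI allI impI disjI1)
      fix s t
      \<comment> \<open>The odd constant \<open>c\<close> is here
        \<open>2 * int D + 5\<close>.\<close>
      have "a k = of_int (2 * int D + 5 - 4 * int k)" for k
        by (simp add: a_def)
      then show "Determinant.det (Matrix.mat (t + 1 - s) (t + 1 - s) (\<lambda>(i, j). ?U (s + i) (s + j))) \<noteq> 0"
        by (rule det_parameters_nonzero[rotated]) simp
    qed (use nonzero in \<open>auto simp: parameters_def\<close>)
    show "uniform_relation D ?B x i (e_minus ?U i) (e_plus D ?U i) (f i)" if i: "i \<in> {1..D}" for i
    proof -
      \<comment> \<open>At \<open>i = 1\<close> and \<open>i = D\<close> the respective coefficient
        is 0 by definition, and the condition on it is void.\<close>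
      have "uniform_relation D ?B x i (e_minus ?U i) (e_plus D ?U i) (- a i * (a i - 4))"
        by (rule B.uniform_relation) (use i minus plus a in auto)
      then show ?thesis
        using i by (simp only: f atLeastAtMost_iff)
    qed
    show "e_minus ?U i \<noteq> 0" if "i \<in> {2..D}" for i
      using that nonzero[of i] by (simp add: minus)
    show "e_plus D ?U i \<noteq> 0" if "i \<in> {1..D - 1}" for i
      using that nonzero[of i] by (auto simp: plus)
  qed
  ultimately show ?thesis
    unfolding supports_strongly_uniform_structure_def
    using graph_diameter_halved_cube[OF n] by auto
qed

end
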